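(* Let $f:[0,1]\to[0,1]$ be continuous and let $\mathcal I^1,\mathcal I^2$ be cycles of $f$ such that $\mathcal I^2$ refines $\mathcal I^1$ (written $\mathcal I^1\supset\mathcal I^2$). Then the pair $\mathcal I^1\supset\mathcal I^2$ admits a splitting; that is, there exists a set $P\subset[0,1]$ of periodic points of $f$, invariant under $f$, such that $P\subset\mathcal G(\mathcal I^1,\mathcal I^2)$ and every gap of the pair $\mathcal I^1\supset\mathcal I^2$ contains exactly one point of $P$.
   Context: A cycle of a continuous map $f:[0,1]\to[0,1]$ is a finite collection $\mathcal I=\{I_0,I_1,\dots,I_{q-1}\}$ ($q\ge 1$) of pairwise disjoint closed subintervals of $[0,1]$ (single points are allowed as degenerate intervals) which are cyclically permuted by $f$ in the sense that $f(I_i)\subset I_{i+1 \bmod q}$ for all $i$. A cycle $\mathcal I^2$ refines a cycle $\mathcal I^1$, written $\mathcal I^1\supset\mathcal I^2$, if $\bigcup_{J\in\mathcal I^2}J\subset\bigcup_{I\in\mathcal I^1}I$ and, denoting by $a_{1,2}$ the number such that every interval of $\mathcal I^1$ contains exactly $a_{1,2}$ intervals of $\mathcal I^2$ (such a number exists), one has $a_{1,2}\ge 2$. If $\mathcal I^2$ refines $\mathcal I^1$, a gap of the pair is a connected component $G$ of $\bigcup_{I\in\mathcal I^1}I\setminus\bigcup_{J\in\mathcal I^2}J$ with $\partial G\subset\bigcup_{J\in\mathcal I^2}J$ (i.e. an open interval lying between two consecutive intervals of $\mathcal I^2$ contained in the same interval of $\mathcal I^1$). The union of all gaps is denoted $\mathcal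 G(\mathcal I^1,\mathcal I^2)$. *)

theory Defs
  imports "HOL-Analysis.Analysis"
begin

text \<open>Maps of \<open>[0,1]\<close> are total functions on the reals of which only the restriction to
  \<open>{0..1}\<close> is used. The condition \<open>a \<le> b\<close> allows single points and excludes the empty set,
  so that pairwise disjoint members are also pairwise distinct.\<close>

definition interval_cycle :: "(real \<Rightarrow> real) \<Rightarrow> real set set \<Rightarrow> bool" where
  "interval_cycle f \<I> \<longleftrightarrow>
     (\<exists>q\<ge>1. \<exists>I :: nat \<Rightarrow> real set.
        \<I> = I ` {..<q} \<and>
        (\<forall>i<q. \<exists>a b. 0 \<le> a \<and> a \<le> b \<and> b \<le> 1 \<and> I i = {a..b}) \<and>
        disjoint_family_on I {..<q} \<and>
        (\<forall>i<q. f ` I i \<subseteq> I (Suc i mod q)))"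

text \<open>For cycles, a number \<open>a\<close> as below (without the bound \<open>a \<ge> 2\<close>) always exists, see
  \<open>refinement_number_exists\<close>, so the only content of the second conjunct is \<open>a \<ge> 2\<close>.\<close>

definition cycle_refines :: "real set set \<Rightarrow> real set set \<Rightarrow> bool" where
  "cycle_refines \<I>2 \<I>1 \<longleftrightarrow>
     \<Union>\<I>2 \<subseteq> \<Union>\<I>1 \<and> (\<exists>a\<ge>2. \<forall>I\<in>\<I>1. card {J \<in> \<I>2. J \<subseteq> I} = a)"

text \<open>The boundary is taken in the real line, not relative to \<open>[0,1]\<close>: a component such as
  \<open>{0..<c}\<close>, which has an interval of \<open>\<I>2\<close> on one side only, must not count as a gap.\<close>

definition gaps :: "real set set \<Rightarrow> real set set \<Rightarrow> real set set" where
  "gaps \<I>1 \<I>2 = {G \<in> components (\<Union>\<I>1 - \<Union>\<I>2). frontier G \<subseteq> \<Union>\<I>2}"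

definition periodic_point :: "('a \<Rightarrow> 'a) \<Rightarrow> 'a \<Rightarrow> bool" where
  "periodic_point f x \<longleftrightarrow> (\<exists>n\<ge>1. (f ^^ n) x = x)"

definition splitting ::
    "(real \<Rightarrow> real) \<Rightarrow> real set set \<Rightarrow> real set set \<Rightarrow> real set \<Rightarrow> bool" where
  "splitting f \<I>1 \<I>2 P \<longleftrightarrow>
     P \<subseteq> {0..1} \<and>
     (\<forall>x\<in>P. periodic_point f x) \<and>
     f ` P \<subseteq> P \<and>
     P \<subseteq> \<Union>(gaps \<I>1 \<I>2) \<and>
     (\<forall>G\<in>gaps \<I>1 \<I>2. \<exists>!x. x \<in> P \<and> x \<in> G)"

lemma refinement_number_exists:
  assumes c1: "interval_cycle f \<I>1" and c2: "interval_cycle f \<I>2" and sub: "\<Union>\<I>2 \<subseteq> \<Union>\<I>1"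
  shows "\<exists>a. \<forall>I\<in>\<I>1. card {J \<in> \<I>2. J \<subseteq> I} = a"
proof -
  obtain q I where q: "q \<ge> 1" "\<I>1 = I ` {..<q}"
    and Iiv: "\<forall>i<q. \<exists>a b. 0 \<le> a \<and> a \<le> b \<and> b \<le> 1 \<and> I i = {a..b}"
    and Idj: "disjoint_family_on I {..<q}"
    and If: "\<forall>i<q. f ` I i \<subseteq> I (Suc i mod q)"
    using c1 unfolding interval_cycle_def by blast
  obtain r K where r: "r \<ge> 1" "\<I>2 = K ` {..<r}"
    and Kiv: "\<forall>j<r. \<exists>a b. 0 \<le> a \<and> a \<le> b \<and> b \<le> 1 \<and> K j = {a..b}"
    and Kdj: "disjoint_family_on K {..<r}"
    and Kf: "\<forall>j<r. f ` K j \<subseteq> K (Suc j mod r)"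
    using c2 unfolding interval_cycle_def by blast
  have Icl: "closed (I i)" if "i < q" for i
    using Iiv that by force
  have Kne: "K j \<noteq> {}" and Kcon: "connected (K j)" if "j < r" for j
    using Kiv that by force+
  have Kinj: "inj_on K {..<r}"
    using Kdj Kne unfolding disjoint_family_on_def inj_on_def by (metis Int_absorb lessThan_iff)
  have step: "K j \<subseteq> I i" if "j < r" "i < q" "K j \<inter> I i \<noteq> {}" for i j
  proof -
    define B where "B = (\<Union>k\<in>{..<q} - {i}. I k)"
    have clB: "closed B" unfolding B_def using Icl by (intro closed_UN) auto
    have disj: "I i \<inter> B = {}"
      using Idj that(2) unfolding B_def disjoint_family_on_def by auto
    have cov: "K j \<subseteq> I i \<union> B" using sub q(2) r(2) that(1) unfolding B_def by blast
    have "I i \<inter> K j = {} \<or> B \<inter> K j = {}"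
      by (rule connected_closedD[OF Kcon[OF that(1)]]) (use disj cov Icl that clB in auto)
    then show ?thesis using that(3) cov by blast
  qed
  define N where "N i = card {j. j < r \<and> K j \<subseteq> I i}" for i
  have cardN: "card {J \<in> \<I>2. J \<subseteq> I i} = N i" for i
  proof -
    have "{J \<in> \<I>2. J \<subseteq> I i} = K ` {j. j < r \<and> K j \<subseteq> I i}" using r(2) by auto
    moreover have "inj_on K {j. j < r \<and> K j \<subseteq> I i}" using Kinj by (rule inj_on_subset) auto
    ultimately show ?thesis by (simp add: N_def card_image)
  qed
  have mono: "N i \<le> N (Suc i mod q)" if "i < q" for i
  proof -
    have inj: "inj_on (\<lambda>j. Suc j mod r) {j. j < r \<and> K j \<subseteq> I i}"
      by (auto simp: inj_on_def mod_Suc split: if_splits)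
    have "(\<lambda>j. Suc j mod r) ` {j. j < r \<and> K j \<subseteq> I i} \<subseteq> {j. j < r \<and> K j \<subseteq> I (Suc i mod q)}"
    proof clarify
      fix j assume j: "j < r" "K j \<subseteq> I i"
      obtain x where "x \<in> K j" using Kne[OF j(1)] by blast
      then have "f x \<in> K (Suc j mod r)" "f x \<in> I (Suc i mod q)"
        using Kf If that j by blast+
      moreover have "Suc j mod r < r" "Suc i mod q < q" using q(1) r(1) by auto
      ultimately show "Suc j mod r < r \<and> K (Suc j mod r) \<subseteq> I (Suc i mod q)"
        using step by blast
    qed
    then show ?thesis unfolding N_def by (intro card_inj_on_le[OF inj]) auto
  qed
  have mono': "N i \<le> N ((i + k) mod q)" if "i < q" for i k
  proof (induction k)
    case 0
    then show ?case using that by simp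
  next
    case (Suc k)
    have "N ((i + k) mod q) \<le> N (Suc ((i + k) mod q) mod q)" using q(1) by (intro mono) auto
    then show ?case using Suc by (simp add: mod_Suc_eq)
  qed
  have N0: "N i = N 0" if "i < q" for i
  proof (rule antisym)
    have "(i + (q - i)) mod q = 0" using that by simp
    then show "N i \<le> N 0" using mono'[OF that, of "q - i"] by metis
    show "N 0 \<le> N i" using mono'[of 0 i] that by simp
  qed
  show ?thesis
  proof (rule exI[of _ "N 0"], rule ballI)
    fix A assume "A \<in> \<I>1"
    then obtain i where i: "i < q" "A = I i" unfolding q(2) by blast
    show "card {J \<in> \<I>2. J \<subseteq> A} = N 0"
      unfolding i(2) cardN by (rule N0[OF i(1)])
  qed
qed

end

theory Submission
  imports Defs "Jordan_Normal_Form.Determinant" "HOL-Combinatorics.Cycles"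
begin

text \<open>Number the intervals of \<open>\<I>2\<close> from left to right as \<open>J\<^sub>0, \<dots>, J\<^bsub>r-1\<^esub>\<close>, with
  \<open>J\<^sub>k = [a\<^sub>k, b\<^sub>k]\<close>. A gap is then an interval \<open>(b\<^sub>k, a\<^bsub>k+1\<^esub>)\<close> such that \<open>J\<^sub>k\<close> and \<open>J\<^bsub>k+1\<^esub>\<close> lie in
  the same interval of \<open>\<I>1\<close> (\<open>gaps_ordered_intervals\<close>), and is numbered \<open>k\<close>. The map permutes the
  numbers of the intervals by an \<open>r\<close>-cycle \<open>\<pi>\<close>. By the intermediate value theorem the image of
  the closure of gap \<open>k\<close> contains the closure of every gap between \<open>J\<^bsub>\<pi> k\<^esub>\<close> and
  \<open>J\<^bsub>\<pi> (k+1)\<^esub>\<close>.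

  Since \<open>P\<close> is to be invariant, finite and made of periodic points, \<open>f\<close> must permute \<open>P\<close>, so a
  permutation \<open>\<sigma>\<close> of the gaps is needed for which gap \<open>k\<close> covers gap \<open>\<sigma> k\<close>. It comes from linear
  algebra (\<open>gap_transversal\<close>). Record the covering relation in a square matrix, with the sign telling
  whether the covering keeps or reverses the orientation. This is the matrix by which \<open>\<pi>\<close> acts
  on the differences \<open>J\<^bsub>k+1\<^esub> - J\<^sub>k\<close>; it is invertible because \<open>\<pi>\<close> is. So some term of the Leibniz
  expansion of its determinant does not vanish, and that term is the permutation \<open>\<sigma>\<close>.

  A cycle of \<open>\<sigma>\<close> of length \<open>n\<close> is a loop of coverings, which yields a point \<open>x\<close> with
  \<open>f\<^sup>n x = x\<close> whose orbit runs through the closed gaps of the loop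
  (\<open>covering_loop_periodic_point\<close>). If the orbit met \<open>\<Union>\<I>2\<close>, in particular at an
  endpoint of a gap, then \<open>\<pi>\<^sup>n\<close> would fix some number and \<open>r\<close> would divide \<open>n\<close>. But there
  are fewer gaps than intervals of \<open>\<I>2\<close>, so \<open>1 \<le> n < r\<close>. The orbit therefore stays in the open
  gaps. One such orbit for every cycle of \<open>\<sigma>\<close> (\<open>equivariant_choice\<close>) gives \<open>P\<close>.\<close>

section \<open>A permutation of the gaps\<close>

text \<open>A matrix with trivial kernel has a nonzero determinant, so one of the products in the Leibniz
  expansion has no zero factor.\<close>

lemma nonvanishing_transversal:
  fixes M :: "nat \<Rightarrow> nat \<Rightarrow> real"
  assumes ker: "\<And>v. \<forall>k<r. (\<Sum>h<r. M k h * v h) = 0 \<Longrightarrow> \<forall>h<r. v h = 0"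
  shows "\<exists>p. p permutes {..<r} \<and> (\<forall>k<r. M k (p k) \<noteq> 0)"
proof -
  define A where "A = mat r r (\<lambda>(k, h). M k h)"
  have A: "A \<in> carrier_mat r r"
    by (simp add: A_def)
  have "Determinant.det A \<noteq> 0"
  proof
    assume "Determinant.det A = 0"
    then obtain v where v: "v \<in> carrier_vec r" "v \<noteq> 0\<^sub>v r" "A *\<^sub>v v = 0\<^sub>v r"
      using det_0_iff_vec_prod_zero_field[OF A] by blast
    have "(\<Sum>h<r. M k h * vec_index v h) = 0" if "k < r" for k
    proof -
      have "(\<Sum>h<r. M k h * vec_index v h) = vec_index (A *\<^sub>v v) k"
        using that v(1) by (simp add: A_def scalar_prod_def lessThan_atLeast0)
      then show ?thesis
        using v(3) that by simp
    qed
    then have "\<forall>h<r. vec_index v h = 0"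
      using ker by blast
    then have "v = 0\<^sub>v r"
      using v(1) by (intro eq_vecI) auto
    then show False
      using v(2) by simp
  qed
  then obtain p where p: "p permutes {0..<r}" "signof p * (\<Prod>i = 0..<r. A $$ (i, p i)) \<noteq> 0"
    unfolding det_def'[OF A] by (metis (mono_tags, lifting) mem_Collect_eq sum.neutral)
  have "M k (p k) \<noteq> 0" if "k < r" for k
  proof -
    have "p k < r"
      using permutes_in_image[OF p(1), of k] that by simp
    moreover have "A $$ (k, p k) \<noteq> 0"
      using p(2) that by auto
    ultimately show ?thesis
      using that by (simp add: A_def)
  qed
  then show ?thesis
    using p(1) by (auto simp: lessThan_atLeast0)
qed

text \<open>Here \<open>\<beta> k\<close> stands for the block (the interval of \<open>\<I>1\<close>) that contains the \<open>k\<close>-th of \<open>r\<close>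
  intervals, and a gap carries the number of the interval on its left.\<close>

definition gap_indices :: "nat \<Rightarrow> (nat \<Rightarrow> 'b) \<Rightarrow> nat set" where
  "gap_indices r \<beta> = {k. Suc k < r \<and> \<beta> k = \<beta> (Suc k)}"

text \<open>If \<open>v\<close> assigns a length to every gap and \<open>X m\<close> is the resulting position of the \<open>m\<close>-th interval,
  then row \<open>k\<close> of the covering matrix computes \<open>X (\<pi> (k+1)) - X (\<pi> k)\<close>. When all rows vanish,
  \<open>X \<circ> \<pi>\<close> is constant on blocks; since \<open>\<pi>\<close> maps blocks onto blocks, so is \<open>X\<close>, and hence every
  length is zero.\<close>

lemma gap_transversal:
  fixes \<pi> :: "nat \<Rightarrow> nat" and \<beta> :: "nat \<Rightarrow> 'b"
  assumes bij: "bij_betw \<pi> {..<r} {..<r}"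
    and conv: "\<And>k l m. k \<le> l \<Longrightarrow> l \<le> m \<Longrightarrow> m < r \<Longrightarrow> \<beta> k = \<beta> m \<Longrightarrow> \<beta> l = \<beta> m"
    and block: "\<And>k l. k < r \<Longrightarrow> l < r \<Longrightarrow> \<beta> (\<pi> k) = \<beta> (\<pi> l) \<longleftrightarrow> \<beta> k = \<beta> l"
  shows "\<exists>\<sigma>. \<sigma> permutes gap_indices r \<beta> \<and>
    (\<forall>k\<in>gap_indices r \<beta>. \<pi> k \<le> \<sigma> k \<and> \<sigma> k < \<pi> (Suc k) \<or> \<pi> (Suc k) \<le> \<sigma> k \<and> \<sigma> k < \<pi> k)"
proof -
  let ?G = "gap_indices r \<beta>"
  \<comment> \<open>Padding with rows of the identity makes the index set \<open>{..<r}\<close> and forces the permutation to fix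
      everything that is not a gap.\<close>
  define M :: "nat \<Rightarrow> nat \<Rightarrow> real" where
    "M k h = (if k \<in> ?G then of_bool (h < \<pi> (Suc k)) - of_bool (h < \<pi> k) else of_bool (h = k))"
    for k h
  have \<pi>r: "\<pi> k < r" if "k < r" for k
    using bij_betwE[OF bij] that by auto
  have "\<forall>h<r. v h = 0" if v: "\<forall>k<r. (\<Sum>h<r. M k h * v h) = 0" for v
  proof -
    \<comment> \<open>The sum may run over all indices below \<open>m\<close>: the padding makes \<open>v\<close> vanish off the gaps.\<close>
    define X where "X m = (\<Sum>h<m. v h)" for m
    have cut: "(\<Sum>h<r. of_bool (h < m) * v h) = X m" if "m < r" for m
      unfolding X_def by (rule sum.mono_neutral_cong_right) (use that in auto)
    have edge: "X (\<pi> (Suc k)) = X (\<pi> k)" if "k \<in> ?G" for k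
    proof -
      have k: "k < r" "Suc k < r"
        using that by (auto simp: gap_indices_def)
      have "0 = (\<Sum>h<r. M k h * v h)"
        using v k by simp
      also have "\<dots> = (\<Sum>h<r. of_bool (h < \<pi> (Suc k)) * v h - of_bool (h < \<pi> k) * v h)"
        using that by (simp add: M_def left_diff_distrib)
      also have "\<dots> = X (\<pi> (Suc k)) - X (\<pi> k)"
        by (simp only: sum_subtractf cut[OF \<pi>r[OF k(1)]] cut[OF \<pi>r[OF k(2)]])
      finally show ?thesis
        by simp
    qed
    have const: "X (\<pi> k) = X (\<pi> m)" if "k \<le> m" "m < r" "\<beta> k = \<beta> m" for k m
      using that
    proof (induction m rule: dec_induct)
      case (step m)
      have "\<beta> m = \<beta> (Suc m)"
        using conv[of k m "Suc m"] step by auto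
      then have "m \<in> ?G"
        using step by (simp add: gap_indices_def)
      then show ?case
        using edge[of m] step \<open>\<beta> m = \<beta> (Suc m)\<close> by auto
    qed simp
    have const': "X (\<pi> k) = X (\<pi> m)" if "k < r" "m < r" "\<beta> k = \<beta> m" for k m
      using const[OF _ that(2,3)] const[OF _ that(1) that(3)[symmetric]] by (metis nat_le_linear)
    show ?thesis
    proof (intro allI impI)
      fix h assume h: "h < r"
      show "v h = 0"
      proof (cases "h \<in> ?G")
        case True
        then have "Suc h < r" "\<beta> h = \<beta> (Suc h)"
          by (auto simp: gap_indices_def)
        moreover obtain k where k: "k < r" "\<pi> k = h"
          using bij h by (metis bij_betw_def imageE lessThan_iff)
        moreover obtain m where m: "m < r" "\<pi> m = Suc h"
          using bij \<open>Suc h < r\<close> by (metis bij_betw_def imageE lessThan_iff)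
        ultimately have "X h = X (Suc h)"
          using const'[of k m] block[of k m] by simp
        then show ?thesis
          by (simp add: X_def)
      next
        case False
        then have "(\<Sum>l<r. M h l * v l) = v h"
          using h by (simp add: M_def of_bool_def if_distrib[of "\<lambda>x. x * _"] cong: if_cong)
        then show ?thesis
          using v h by simp
      qed
    qed
  qed
  then obtain \<sigma> where \<sigma>: "\<sigma> permutes {..<r}" "\<forall>k<r. M k (\<sigma> k) \<noteq> 0"
    using nonvanishing_transversal[of r M] by blast
  have fixed: "\<sigma> k = k" if "k \<notin> ?G" for k
  proof (cases "k < r")
    case True
    then have "M k (\<sigma> k) \<noteq> 0"
      using \<sigma>(2) by blast
    then show ?thesis
      using that by (simp add: M_def split: if_splits)
  next
    case False
    then show ?thesis
      using permutes_not_in[OF \<sigma>(1)] by simp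
  qed
  have "\<sigma> permutes ?G"
    using permutes_superset[OF \<sigma>(1), of ?G] fixed by blast
  moreover have "\<pi> k \<le> \<sigma> k \<and> \<sigma> k < \<pi> (Suc k) \<or> \<pi> (Suc k) \<le> \<sigma> k \<and> \<sigma> k < \<pi> k"
    if "k \<in> ?G" for k
  proof -
    have "k < r"
      using that by (simp add: gap_indices_def)
    then have "M k (\<sigma> k) \<noteq> 0"
      using \<sigma>(2) by blast
    then show ?thesis
      using that by (auto simp: M_def of_bool_def not_less split: if_splits)
  qed
  ultimately show ?thesis
    by blast
qed

section \<open>Loops of coverings\<close>

text \<open>Take the first point \<open>d'\<close> where \<open>h\<close> reaches \<open>\<beta>\<close>, and then the last point \<open>c'\<close> before it where
  \<open>h\<close> is \<open>\<alpha>\<close>; in between \<open>h\<close> can leave \<open>[\<alpha>, \<beta>]\<close> at neither end.\<close>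

lemma exact_subinterval_increasing:
  fixes h :: "real \<Rightarrow> real"
  assumes cd: "c \<le> d" and h: "continuous_on {c..d} h"
    and le: "h c \<le> \<alpha>" "\<alpha> \<le> \<beta>" "\<beta> \<le> h d"
  obtains c' d' where "c \<le> c'" "c' \<le> d'" "d' \<le> d" "h c' = \<alpha>" "h d' = \<beta>"
    "h ` {c'..d'} \<subseteq> {\<alpha>..\<beta>}"
proof -
  have cptS: "compact {x \<in> {c..e}. h x = y}" if "e \<le> d" for y e
  proof -
    have "closed ({c..e} \<inter> h -` {y})"
      by (intro continuous_closed_preimage continuous_on_subset[OF h]) (use that in auto)
    then have "compact ({c..e} \<inter> h -` {y})"
      using bounded_subset[OF bounded_closed_interval, of _ c e] by (simp add: compact_eq_bounded_closed)
    then show ?thesis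
      by (simp add: vimage_def Int_def)
  qed
  have "\<exists>x\<ge>c. x \<le> d \<and> h x = \<beta>"
    by (rule IVT') (use assms in auto)
  then obtain d' where d': "d' \<in> {c..d}" "h d' = \<beta>"
    and min: "\<And>x. x \<in> {c..d} \<Longrightarrow> h x = \<beta> \<Longrightarrow> d' \<le> x"
    using compact_attains_inf[OF cptS[of d \<beta>]] by auto
  have "\<exists>x\<ge>c. x \<le> d' \<and> h x = \<alpha>"
    by (rule IVT') (use assms d' in \<open>auto intro: continuous_on_subset\<close>)
  then obtain c' where c': "c' \<in> {c..d'}" "h c' = \<alpha>"
    and max: "\<And>x. x \<in> {c..d'} \<Longrightarrow> h x = \<alpha> \<Longrightarrow> x \<le> c'"
    using compact_attains_sup[OF cptS[of d' \<alpha>]] d'(1) by auto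
  have "\<alpha> \<le> h x \<and> h x \<le> \<beta>" if x: "c' \<le> x" "x \<le> d'" for x
  proof (rule conjI; rule ccontr)
    assume "\<not> \<alpha> \<le> h x"
    then have "\<exists>y\<ge>x. y \<le> d' \<and> h y = \<alpha>"
      by (intro IVT') (use le d' c' x in \<open>auto intro: continuous_on_subset[OF h]\<close>)
    then obtain y where "y \<ge> x" "y \<le> d'" "h y = \<alpha>"
      by blast
    then have "x = c'"
      using max[of y] x c'(1) by auto
    then show False
      using \<open>\<not> \<alpha> \<le> h x\<close> c'(2) by simp
  next
    assume "\<not> h x \<le> \<beta>"
    then have "\<exists>y\<ge>c. y \<le> x \<and> h y = \<beta>"
      by (intro IVT') (use le d' c' x in \<open>auto intro: continuous_on_subset[OF h]\<close>)
    then obtain y where "y \<ge> c" "y \<le> x" "h y = \<beta>"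
      by blast
    then have "x = d'"
      using min[of y] x d'(1) by auto
    then show False
      using \<open>\<not> h x \<le> \<beta>\<close> d'(2) by simp
  qed
  then show ?thesis
    using c' d' by (intro that[of c' d']) auto
qed

lemma exact_subinterval:
  fixes h :: "real \<Rightarrow> real"
  assumes cd: "c \<le> d" and h: "continuous_on {c..d} h" and ab: "\<alpha> \<le> \<beta>"
    and cover: "h c \<le> \<alpha> \<and> \<beta> \<le> h d \<or> h d \<le> \<alpha> \<and> \<beta> \<le> h c"
  obtains c' d' where "c \<le> c'" "c' \<le> d'" "d' \<le> d"
    "h c' = \<alpha> \<and> h d' = \<beta> \<or> h c' = \<beta> \<and> h d' = \<alpha>" "h ` {c'..d'} \<subseteq> {\<alpha>..\<beta>}"
  using cover
proof
  assume "h c \<le> \<alpha> \<and> \<beta> \<le> h d"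
  then show ?thesis
    using exact_subinterval_increasing[OF cd h, of \<alpha> \<beta>] ab that by metis
next
  assume "h d \<le> \<alpha> \<and> \<beta> \<le> h c"
  then obtain c' d' where "c \<le> c'" "c' \<le> d'" "d' \<le> d" "- h c' = - \<beta>" "- h d' = - \<alpha>"
    "(\<lambda>x. - h x) ` {c'..d'} \<subseteq> {- \<beta>..- \<alpha>}"
    using exact_subinterval_increasing[OF cd continuous_on_minus[OF h], of "- \<beta>" "- \<alpha>"] ab
    by (metis neg_le_iff_le)
  then show ?thesis
    by (intro that[of c' d']) auto
qed

text \<open>Pulling the covered intervals back one step at a time shrinks \<open>[c, d]\<close>. That the endpoints are
  mapped exactly to the endpoints of the last interval is what lets the next covering apply.\<close>

lemma covering_chain:
  fixes f :: "real \<Rightarrow> real" and u v :: "nat \<Rightarrow> real"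
  assumes le: "\<And>k. u k \<le> v k"
    and cont: "\<And>k. continuous_on {u k..v k} f"
    and cover: "\<And>k. f (u k) \<le> u (Suc k) \<and> v (Suc k) \<le> f (v k) \<or>
                     f (v k) \<le> u (Suc k) \<and> v (Suc k) \<le> f (u k)"
  shows "\<exists>c d. c \<le> d \<and> continuous_on {c..d} (f ^^ n) \<and>
    (\<forall>k\<le>n. (f ^^ k) ` {c..d} \<subseteq> {u k..v k}) \<and>
    ((f ^^ n) c = u n \<and> (f ^^ n) d = v n \<or> (f ^^ n) c = v n \<and> (f ^^ n) d = u n)"
proof (induction n)
  case 0
  then show ?case
    using le[of 0] by (intro exI[of _ "u 0"] exI[of _ "v 0"]) auto
next
  case (Suc n)
  then obtain c d where cd: "c \<le> d" "continuous_on {c..d} (f ^^ n)"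
    and itin: "\<forall>k\<le>n. (f ^^ k) ` {c..d} \<subseteq> {u k..v k}"
    and ends: "(f ^^ n) c = u n \<and> (f ^^ n) d = v n \<or> (f ^^ n) c = v n \<and> (f ^^ n) d = u n"
    by blast
  have cont': "continuous_on {c..d} (f ^^ Suc n)"
    unfolding funpow.simps using cd(2) itin
    by (intro continuous_on_compose continuous_on_subset[OF cont[of n]]) auto
  have "(f ^^ Suc n) c \<le> u (Suc n) \<and> v (Suc n) \<le> (f ^^ Suc n) d \<or>
        (f ^^ Suc n) d \<le> u (Suc n) \<and> v (Suc n) \<le> (f ^^ Suc n) c"
    using ends cover[of n] by auto
  then obtain c' d' where c'd': "c \<le> c'" "c' \<le> d'" "d' \<le> d"
    and ends': "(f ^^ Suc n) c' = u (Suc n) \<and> (f ^^ Suc n) d' = v (Suc n) \<or>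
      (f ^^ Suc n) c' = v (Suc n) \<and> (f ^^ Suc n) d' = u (Suc n)"
    and img: "(f ^^ Suc n) ` {c'..d'} \<subseteq> {u (Suc n)..v (Suc n)}"
    using exact_subinterval[OF cd(1) cont' le[of "Suc n"]] by metis
  have sub: "{c'..d'} \<subseteq> {c..d}"
    using c'd' by auto
  have "\<forall>k\<le>Suc n. (f ^^ k) ` {c'..d'} \<subseteq> {u k..v k}"
    using itin img sub by (metis image_mono le_Suc_eq order_trans)
  then show ?case
    using c'd'(2) ends' continuous_on_subset[OF cont' sub] by blast
qed

text \<open>When the chain closes up, \<open>f\<^sup>n\<close> maps the endpoints of \<open>[c, d]\<close> to those of an interval that
  contains \<open>[c, d]\<close>, so \<open>f\<^sup>n x - x\<close> changes sign.\<close>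

lemma covering_loop_periodic_point:
  fixes f :: "real \<Rightarrow> real" and u v :: "nat \<Rightarrow> real"
  assumes le: "\<And>k. u k \<le> v k"
    and cont: "\<And>k. continuous_on {u k..v k} f"
    and cover: "\<And>k. f (u k) \<le> u (Suc k) \<and> v (Suc k) \<le> f (v k) \<or>
                     f (v k) \<le> u (Suc k) \<and> v (Suc k) \<le> f (u k)"
    and loop: "u n = u 0" "v n = v 0"
  shows "\<exists>x. (f ^^ n) x = x \<and> (\<forall>k\<le>n. (f ^^ k) x \<in> {u k..v k})"
proof -
  obtain c d where cd: "c \<le> d" "continuous_on {c..d} (f ^^ n)"
    and itin: "\<And>k. k \<le> n \<Longrightarrow> (f ^^ k) ` {c..d} \<subseteq> {u k..v k}"
    and ends: "(f ^^ n) c = u n \<and> (f ^^ n) d = v n \<or> (f ^^ n) c = v n \<and> (f ^^ n) d = u n"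
    using covering_chain[of u v f n] le cont cover by blast
  have uv: "u 0 \<le> c" "d \<le> v 0"
    using itin[of 0] cd(1) by auto
  have cont': "continuous_on {c..d} (\<lambda>x. (f ^^ n) x - x)"
    by (intro continuous_intros cd(2))
  have "\<exists>x\<ge>c. x \<le> d \<and> (f ^^ n) x - x = 0"
    using ends
  proof
    assume "(f ^^ n) c = u n \<and> (f ^^ n) d = v n"
    then show ?thesis
      using IVT'[of "\<lambda>x. (f ^^ n) x - x" c 0 d] cont' cd(1) uv loop by auto
  next
    assume "(f ^^ n) c = v n \<and> (f ^^ n) d = u n"
    then show ?thesis
      using IVT2'[of "\<lambda>x. (f ^^ n) x - x" d 0 c] cont' cd(1) uv loop by auto
  qed
  then obtain x where "c \<le> x" "x \<le> d" "(f ^^ n) x = x"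
    by auto
  moreover have "(f ^^ k) x \<in> {u k..v k}" if "k \<le> n" for k
    using itin[OF that] \<open>c \<le> x\<close> \<open>x \<le> d\<close> by (metis atLeastAtMost_iff image_subset_iff)
  ultimately show ?thesis
    by blast
qed

section \<open>Choosing points compatibly along a permutation\<close>

text \<open>A choice of points for all \<open>k\<close> at once has to commute with the dynamics. So a point \<open>x\<close> is
  chosen only for one representative of every cycle of \<open>\<sigma>\<close> and transported by \<open>f\<close>. Two ways to reach the same element
  of the cycle differ by a multiple of the cycle length, which is a period of \<open>x\<close>, so the
  transported point is well defined.\<close>

lemma equivariant_choice:
  fixes \<sigma> :: "'a \<Rightarrow> 'a" and f :: "'b \<Rightarrow> 'b"
  assumes perm: "permutation \<sigma>" and G: "\<And>k. k \<in> G \<Longrightarrow> \<sigma> k \<in> G"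
    and loop: "\<And>k. k \<in> G \<Longrightarrow> \<exists>x. (f ^^ least_power \<sigma> k) x = x \<and> (\<forall>j. R ((\<sigma> ^^ j) k) ((f ^^ j) x))"
  shows "\<exists>p. \<forall>k\<in>G. R k (p k) \<and> p (\<sigma> k) = f (p k) \<and> periodic_point f (p k)"
proof -
  define orb where "orb k = range (\<lambda>i. (\<sigma> ^^ i) k)" for k
  have sub: "orb h \<subseteq> orb k" if "h \<in> orb k" for h k
    using that unfolding orb_def by (auto simp flip: funpow_add[THEN fun_cong, unfolded o_apply])
  have orb_sym: "k \<in> orb h" if "h \<in> orb k" for h k
  proof -
    obtain i where i: "h = (\<sigma> ^^ i) k"
      using \<open>h \<in> orb k\<close> by (auto simp: orb_def)
    let ?n = "least_power \<sigma> k"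
    have "?n \<ge> 1"
      using least_power_of_permutation(2)[OF perm, of k] by simp
    then have "(?n * i - i) + i = ?n * i"
      by simp
    then have "(\<sigma> ^^ (?n * i - i)) h = (\<sigma> ^^ (?n * i)) k"
      unfolding i by (metis comp_apply funpow_add)
    also have "\<dots> = k"
      using least_power_dvd[OF perm] by (metis dvd_triv_left)
    finally show ?thesis
      unfolding orb_def by (metis rangeI)
  qed
  have orb_eq: "orb h = orb k" if "h \<in> orb k" for h k
    using sub orb_sym that by blast
  have self: "k \<in> orb k" for k
    unfolding orb_def by (metis funpow_0 rangeI)
  define rep where "rep k = (SOME h. h \<in> orb k)" for k
  have rep: "rep k \<in> orb k" for k
    unfolding rep_def using self by (rule someI)
  define idx where "idx k = (SOME i. (\<sigma> ^^ i) (rep k) = k)" for k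
  have idx: "(\<sigma> ^^ idx k) (rep k) = k" for k
  proof -
    have "\<exists>i. (\<sigma> ^^ i) (rep k) = k"
      using orb_sym[OF rep[of k]] unfolding orb_def by (metis imageE)
    then show ?thesis
      unfolding idx_def by (rule someI_ex)
  qed
  define x where "x k = (SOME x. (f ^^ least_power \<sigma> k) x = x \<and> (\<forall>j. R ((\<sigma> ^^ j) k) ((f ^^ j) x)))" for k
  have x: "(f ^^ least_power \<sigma> k) (x k) = x k" "R ((\<sigma> ^^ j) k) ((f ^^ j) (x k))" if "k \<in> G" for k j
  proof -
    have "(f ^^ least_power \<sigma> k) (x k) = x k \<and> (\<forall>j. R ((\<sigma> ^^ j) k) ((f ^^ j) (x k)))"
      unfolding x_def by (rule someI_ex[OF loop[OF that]])
    then show "(f ^^ least_power \<sigma> k) (x k) = x k" "R ((\<sigma> ^^ j) k) ((f ^^ j) (x k))"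
      by blast+
  qed
  have Gpow: "(\<sigma> ^^ i) k \<in> G" if "k \<in> G" for i k
    by (induction i) (use G that in auto)
  define p where "p k = (f ^^ idx k) (x (rep k))" for k
  have same: "(f ^^ i) (x h) = (f ^^ j) (x h)" if "h \<in> G" "(\<sigma> ^^ i) h = (\<sigma> ^^ j) h" for h i j
  proof -
    let ?n = "least_power \<sigma> h"
    have *: "(f ^^ i) (x h) = (f ^^ j) (x h)" if "i \<le> j" "(\<sigma> ^^ i) h = (\<sigma> ^^ j) h" for i j
    proof -
      have "(\<sigma> ^^ (j - i)) h = h"
        by (rule funpow_diff[OF bij_is_inj[OF permutation_bijective[OF perm]] that])
      then have "?n dvd j - i"
        using least_power_dvd[OF perm] by blast
      then have "(f ^^ (j - i)) (x h) = x h"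
        using funpow_mod_eq[OF x(1)[OF \<open>h \<in> G\<close>], of "j - i"] by (metis dvd_imp_mod_0 funpow_0)
      then show ?thesis
        using that(1) by (metis comp_apply funpow_add le_add_diff_inverse)
    qed
    show ?thesis
      using * that(2) by (metis nat_le_linear)
  qed
  have "R k (p k) \<and> p (\<sigma> k) = f (p k) \<and> periodic_point f (p k)" if k: "k \<in> G" for k
  proof (intro conjI)
    have repG: "rep k \<in> G"
      using rep[of k] Gpow[OF k] by (auto simp: orb_def)
    show "R k (p k)"
      using x(2)[OF repG, of "idx k"] by (simp add: idx p_def)
    have "\<sigma> k \<in> orb k"
      unfolding orb_def by (rule range_eqI[of _ _ 1]) simp
    then have "rep (\<sigma> k) = rep k"
      using orb_eq[of "\<sigma> k" k] by (simp add: rep_def)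
    moreover from this have "(\<sigma> ^^ idx (\<sigma> k)) (rep k) = (\<sigma> ^^ Suc (idx k)) (rep k)"
      using idx[of k] idx[of "\<sigma> k"] by simp
    ultimately show "p (\<sigma> k) = f (p k)"
      using same[OF repG] unfolding p_def by (metis comp_apply funpow.simps(2))
    let ?n = "least_power \<sigma> (rep k)"
    have "(f ^^ ?n) (p k) = (f ^^ idx k) ((f ^^ ?n) (x (rep k)))"
      unfolding p_def by (metis add.commute comp_apply funpow_add)
    then have "(f ^^ ?n) (p k) = p k"
      using x(1)[OF repG] by (simp add: p_def)
    moreover have "?n \<ge> 1"
      using least_power_of_permutation(2)[OF perm, of "rep k"] by simp
    ultimately show "periodic_point f (p k)"
      unfolding periodic_point_def by blast
  qed
  then show ?thesis
    by blast
qed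

section \<open>Cycles listed from left to right\<close>

lemma connected_in_disjoint_closed:
  fixes I :: "nat \<Rightarrow> 'a::topological_space set"
  assumes K: "connected K" "K \<subseteq> (\<Union>i<q. I i)" "i < q" "K \<inter> I i \<noteq> {}"
    and cl: "\<And>i. i < q \<Longrightarrow> closed (I i)" and disj: "disjoint_family_on I {..<q}"
  shows "K \<subseteq> I i"
proof -
  define B where "B = (\<Union>k\<in>{..<q} - {i}. I k)"
  have clB: "closed B"
    unfolding B_def using cl by (intro closed_UN) auto
  have dj: "I i \<inter> B = {}"
    using disj K(3) unfolding B_def disjoint_family_on_def by auto
  have cov: "K \<subseteq> I i \<union> B"
    using K(2) unfolding B_def by blast
  have "I i \<inter> K = {} \<or> B \<inter> K = {}"
    by (rule connected_closedD[OF K(1)]) (use dj cov cl K(3) clB in auto)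
  then show ?thesis
    using K(4) cov by blast
qed

definition ordered_intervals :: "nat \<Rightarrow> (nat \<Rightarrow> real) \<Rightarrow> (nat \<Rightarrow> real) \<Rightarrow> bool" where
  "ordered_intervals r a b \<longleftrightarrow> (\<forall>k<r. a k \<le> b k) \<and> (\<forall>k l. k < l \<longrightarrow> l < r \<longrightarrow> b k < a l)"

lemma ordered_intervals_index_unique:
  assumes "ordered_intervals r a b" "k < r" "l < r" "x \<in> {a k..b k}" "x \<in> {a l..b l}"
  shows "k = l"
proof (rule ccontr)
  assume "k \<noteq> l"
  then have "b k < a l \<or> b l < a k"
    using assms(1-3) unfolding ordered_intervals_def by (metis nat_neq_iff)
  then show False
    using assms(4,5) by auto
qed

lemma ordered_intervals_index_mono:
  assumes "ordered_intervals r a b" "k < r" "l < r" "x \<in> {a k..b k}" "y \<in> {a l..b l}" "x < y"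
  shows "k \<le> l"
proof (rule ccontr)
  assume "\<not> k \<le> l"
  then have "b l < a k"
    using assms(1-3) unfolding ordered_intervals_def by auto
  then show False
    using assms(4-6) by auto
qed

text \<open>The cyclic numbering and the numbering by position differ by a permutation \<open>s\<close>, so the action
  \<open>\<pi>\<close> of \<open>f\<close> on positions is conjugate to \<open>j \<mapsto> j + 1\<close> modulo \<open>r\<close>. The last conclusion is
  what remains of cyclicity when \<open>s\<close> is forgotten: no position returns before time \<open>r\<close>.\<close>

lemma interval_cycle_ordered:
  assumes "interval_cycle f \<I>"
  obtains r a b \<pi> where "\<I> = (\<lambda>k. {a k..b k}) ` {..<r}"
    and "ordered_intervals r a b"
    and "\<And>k. k < r \<Longrightarrow> {a k..b k} \<subseteq> {0..1}"
    and "bij_betw \<pi> {..<r} {..<r}"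
    and "\<And>k. k < r \<Longrightarrow> f ` {a k..b k} \<subseteq> {a (\<pi> k)..b (\<pi> k)}"
    and "\<And>k n. k < r \<Longrightarrow> (\<pi> ^^ n) k = k \<Longrightarrow> n \<ge> 1 \<Longrightarrow> r \<le> n"
proof -
  obtain r K where r: "r \<ge> 1" and \<I>: "\<I> = K ` {..<r}"
    and ivl: "\<forall>j<r. \<exists>a b. 0 \<le> a \<and> a \<le> b \<and> b \<le> 1 \<and> K j = {a..b}"
    and disj: "disjoint_family_on K {..<r}"
    and Kf: "\<forall>j<r. f ` K j \<subseteq> K (Suc j mod r)"
    using assms unfolding interval_cycle_def by blast
  obtain L R where LR: "\<And>j. j < r \<Longrightarrow> 0 \<le> L j \<and> L j \<le> R j \<and> R j \<le> 1 \<and> K j = {L j..R j}"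
    using ivl by metis
  have uniq: "i = j" if "i < r" "j < r" "x \<in> K i" "x \<in> K j" for i j x
    using disj that unfolding disjoint_family_on_def by blast
  have "inj_on L {..<r}"
  proof (rule inj_onI)
    fix i j assume "i \<in> {..<r}" "j \<in> {..<r}" "L i = L j"
    then show "i = j"
      using uniq[of i j "L i"] LR[of i] LR[of j] by auto
  qed
  define xs where "xs = sorted_list_of_set (L ` {..<r})"
  have len: "length xs = r"
    unfolding xs_def using card_image[OF \<open>inj_on L {..<r}\<close>] by simp
  have xs: "set xs = L ` {..<r}" "sorted_wrt (<) xs" "distinct xs"
    unfolding xs_def by simp_all
  \<comment> \<open>Sorting the left endpoints sorts the intervals.\<close>
  define s where "s k = the_inv_into {..<r} L (xs ! k)" for k
  have s_bij: "bij_betw s {..<r} {..<r}"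
  proof -
    have "bij_betw (\<lambda>k. xs ! k) {..<r} (L ` {..<r})"
      by (rule bij_betw_nth) (use len xs in auto)
    moreover have "bij_betw (the_inv_into {..<r} L) (L ` {..<r}) {..<r}"
      using \<open>inj_on L {..<r}\<close> by (simp add: bij_betw_the_inv_into inj_on_imp_bij_betw)
    ultimately show ?thesis
      using bij_betw_trans unfolding s_def comp_def by blast
  qed
  have s_lt: "s k < r" if "k < r" for k
    using bij_betwE[OF s_bij] that by auto
  have L_s: "L (s k) = xs ! k" if "k < r" for k
  proof -
    have "xs ! k \<in> L ` {..<r}"
      using that len xs(1) nth_mem by metis
    then show ?thesis
      unfolding s_def by (rule f_the_inv_into_f[OF \<open>inj_on L {..<r}\<close>])
  qed
  have L_mono: "L (s k) < L (s l)" if "k < l" "l < r" for k l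
    using sorted_wrt_nth_less[OF xs(2), of k l] that len L_s by simp
  define t where "t = the_inv_into {..<r} s"
  have t_bij: "bij_betw t {..<r} {..<r}"
    unfolding t_def by (rule bij_betw_the_inv_into[OF s_bij])
  have s_t: "s (t j) = j" if "j < r" for j
    unfolding t_def using f_the_inv_into_f_bij_betw[OF s_bij] that by simp
  have t_lt: "t j < r" if "j < r" for j
    using bij_betwE[OF t_bij] that by auto
  define \<pi> where "\<pi> k = t (Suc (s k) mod r)" for k
  have s_\<pi>: "s (\<pi> k) = Suc (s k) mod r" for k
    unfolding \<pi>_def using r by (intro s_t) simp
  have \<pi>_lt: "\<pi> k < r" for k
    unfolding \<pi>_def using r by (intro t_lt) simp
  show ?thesis
  proof (rule that[of "L \<circ> s" "R \<circ> s" r \<pi>])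
    have "K ` {..<r} = K ` s ` {..<r}"
      using s_bij by (simp add: bij_betw_def)
    then show "\<I> = (\<lambda>k. {(L \<circ> s) k..(R \<circ> s) k}) ` {..<r}"
      unfolding \<I> image_image using LR s_lt by (auto cong: image_cong_simp)
    show "ordered_intervals r (L \<circ> s) (R \<circ> s)"
      unfolding ordered_intervals_def
    proof (intro conjI allI impI)
      show "(L \<circ> s) k \<le> (R \<circ> s) k" if "k < r" for k
        using LR s_lt[OF that] by simp
      fix k l assume kl: "k < l" "l < r"
      show "(R \<circ> s) k < (L \<circ> s) l"
      proof (rule ccontr)
        assume "\<not> (R \<circ> s) k < (L \<circ> s) l"
        then have "L (s l) \<in> K (s k)" "L (s l) \<in> K (s l)"
          using LR[OF s_lt] L_mono[OF kl] kl by auto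
        then have "s k = s l"
          using uniq s_lt kl by auto
        then show False
          using L_mono[OF kl] by simp
      qed
    qed
    show "{(L \<circ> s) k..(R \<circ> s) k} \<subseteq> {0..1}" if "k < r" for k
      using LR[OF s_lt[OF that]] by auto
    have "inj_on \<pi> {..<r}"
    proof (rule inj_onI)
      fix k l assume kl: "k \<in> {..<r}" "l \<in> {..<r}" "\<pi> k = \<pi> l"
      then have "Suc (s k) mod r = Suc (s l) mod r"
        using s_\<pi> by metis
      then have "s k = s l"
        using s_lt[of k] s_lt[of l] kl by (auto simp: mod_Suc split: if_splits)
      then show "k = l"
        using s_bij kl unfolding bij_betw_def inj_on_def by blast
    qed
    moreover have "\<pi> ` {..<r} \<subseteq> {..<r}"
      using \<pi>_lt by blast
    ultimately show "bij_betw \<pi> {..<r} {..<r}"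
      by (simp add: bij_betw_def endo_inj_surj)
    show "f ` {(L \<circ> s) k..(R \<circ> s) k} \<subseteq> {(L \<circ> s) (\<pi> k)..(R \<circ> s) (\<pi> k)}" if "k < r" for k
      using Kf s_lt[OF that] LR[OF s_lt[OF that]] LR[OF s_lt[OF \<pi>_lt[of k]]] s_\<pi>[of k] by auto
    show "r \<le> n" if "k < r" "(\<pi> ^^ n) k = k" "n \<ge> 1" for k n
    proof -
      have "s ((\<pi> ^^ n) k) = (s k + n) mod r" for n
      proof (induction n)
        case 0
        then show ?case
          using s_lt[OF that(1)] by simp
      next
        case (Suc n)
        then show ?case
          by (simp add: s_\<pi> mod_Suc_eq)
      qed
      from this[of n] have "(s k + n) mod r = s k mod r"
        using that s_lt[OF that(1)] by simp
      then have "r dvd n"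
        using mod_eq_dvd_iff_nat[of "s k" "s k + n" r] by simp
      then show ?thesis
        using that(3) by (intro dvd_imp_le) auto
    qed
  qed
qed

lemma ordered_intervals_disjoint:
  assumes "ordered_intervals r a b"
  shows "disjoint_family_on (\<lambda>k. {a k..b k}) {..<r}"
  unfolding disjoint_family_on_def
  using ordered_intervals_index_unique[OF assms] by (metis disjoint_iff lessThan_iff)

lemma containing_index_convex:
  assumes I1: "ordered_intervals q c d" and I2: "ordered_intervals r a b"
    and \<beta>: "\<And>k. k < r \<Longrightarrow> \<beta> k < q \<and> {a k..b k} \<subseteq> {c (\<beta> k)..d (\<beta> k)}"
    and klm: "k \<le> l" "l \<le> m" "m < r" "\<beta> k = \<beta> m"
  shows "\<beta> l = \<beta> m"
proof (cases "l = k \<or> l = m")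
  case False
  then have lt: "b k < a l" "b l < a m"
    using I2 klm unfolding ordered_intervals_def by auto
  have le: "a k \<le> b k" "a l \<le> b l" "a m \<le> b m"
    using I2 klm unfolding ordered_intervals_def by auto
  have "a l \<in> {c (\<beta> m)..d (\<beta> m)}" "a l \<in> {c (\<beta> l)..d (\<beta> l)}"
    using \<beta>[of k] \<beta>[of l] \<beta>[of m] klm lt le by auto
  then show ?thesis
    using ordered_intervals_index_unique[OF I1] \<beta>[of l] \<beta>[of m] klm by auto
qed (use klm in auto)

section \<open>The gaps\<close>

lemma open_interval_in_components:
  fixes U V :: "real set"
  assumes "x < y" "{x<..<y} \<subseteq> U - V" "x \<in> V" "y \<in> V"
  shows "{x<..<y} \<in> components (U - V)"
  unfolding in_components_maximal
proof (intro conjI allI impI)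
  show "{x<..<y} \<noteq> {}" "{x<..<y} \<subseteq> U - V" "connected {x<..<y}"
    using assms by auto
  fix D assume D: "D \<noteq> {} \<and> {x<..<y} \<subseteq> D \<and> D \<subseteq> U - V \<and> connected D"
  obtain z where z: "x < z" "z < y"
    using dense[OF assms(1)] by blast
  then have "z \<in> D"
    using D by auto
  have "t \<in> {x<..<y}" if t: "t \<in> D" for t
  proof (rule ccontr)
    assume "t \<notin> {x<..<y}"
    then consider "t \<le> x" | "y \<le> t"
      by fastforce
    then have "x \<in> D \<or> y \<in> D"
    proof cases
      case 1
      then show ?thesis
        using connectedD_interval[of D t z x] D t z \<open>z \<in> D\<close> by auto
    next
      case 2
      then show ?thesis
        using connectedD_interval[of D z t y] D t z \<open>z \<in> D\<close> by auto
    qed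
    then show False
      using D assms(3,4) by blast
  qed
  then show "D = {x<..<y}"
    using D by blast
qed

lemma Inf_Sup_in_frontier:
  fixes C :: "real set"
  assumes "C \<noteq> {}" "bounded C"
  shows "Inf C \<in> frontier C" "Sup C \<in> frontier C"
proof -
  have bd: "bdd_below C" "bdd_above C"
    using assms(2) by (auto simp: bounded_imp_bdd_below bounded_imp_bdd_above)
  have "Inf C \<notin> interior C"
  proof
    assume "Inf C \<in> interior C"
    then obtain e where e: "e > 0" "ball (Inf C) e \<subseteq> C"
      by (auto simp: mem_interior)
    then have "Inf C - e / 2 \<in> C"
      by (auto simp: dist_real_def subset_iff)
    then show False
      using cInf_lower[OF _ bd(1)] e(1) by fastforce
  qed
  then show "Inf C \<in> frontier C"
    using closure_contains_Inf[OF assms(1) bd(1)] by (simp add: frontier_def)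
  have "Sup C \<notin> interior C"
  proof
    assume "Sup C \<in> interior C"
    then obtain e where e: "e > 0" "ball (Sup C) e \<subseteq> C"
      by (auto simp: mem_interior)
    then have "Sup C + e / 2 \<in> C"
      by (auto simp: dist_real_def subset_iff)
    then show False
      using cSup_upper[OF _ bd(2)] e(1) by fastforce
  qed
  then show "Sup C \<in> frontier C"
    using closure_contains_Sup[OF assms(1) bd(2)] by (simp add: frontier_def)
qed

text \<open>A component \<open>C\<close> whose boundary lies in \<open>\<Union>\<I>2\<close> has intervals of \<open>\<I>2\<close> on both sides, those that
  contain \<open>Inf C\<close> and \<open>Sup C\<close>, inside one interval of \<open>\<I>1\<close>. The last interval of \<open>\<I>2\<close> to the left
  of a point of \<open>C\<close> and its successor are then in that interval of \<open>\<I>1\<close> too, by convexity, and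
  bound \<open>C\<close>.\<close>

lemma gaps_ordered_intervals:
  assumes I1: "ordered_intervals q c d" and I2: "ordered_intervals r a b"
    and \<beta>: "\<And>k. k < r \<Longrightarrow> \<beta> k < q \<and> {a k..b k} \<subseteq> {c (\<beta> k)..d (\<beta> k)}"
  shows "gaps ((\<lambda>i. {c i..d i}) ` {..<q}) ((\<lambda>k. {a k..b k}) ` {..<r}) =
    (\<lambda>k. {b k<..<a (Suc k)}) ` gap_indices r \<beta>" (is "gaps ?I1 ?I2 = ?gap ` ?G")
proof -
  have le: "a k \<le> b k" if "k < r" for k
    using I2 that by (simp add: ordered_intervals_def)
  have lt: "b k < a l" if "k < l" "l < r" for k l
    using I2 that by (simp add: ordered_intervals_def)
  have comp: "?gap k \<in> components (\<Union>?I1 - \<Union>?I2)" and ends: "b k \<in> \<Union>?I2" "a (Suc k) \<in> \<Union>?I2"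
    and less: "b k < a (Suc k)" if k: "k \<in> ?G" for k
  proof -
    have kr: "Suc k < r" "k < r" "\<beta> k = \<beta> (Suc k)"
      using k by (auto simp: gap_indices_def)
    show ends: "b k \<in> \<Union>?I2" "a (Suc k) \<in> \<Union>?I2"
      using kr le[of k] le[of "Suc k"] by auto
    show less: "b k < a (Suc k)"
      using lt kr by simp
    have "?gap k \<subseteq> {c (\<beta> k)..d (\<beta> k)}"
      using \<beta>[of k] \<beta>[of "Suc k"] kr le[of k] le[of "Suc k"] by auto
    moreover have "\<beta> k < q"
      using \<beta> kr by blast
    ultimately have "?gap k \<subseteq> \<Union>?I1"
      by blast
    moreover have "x \<notin> {a l..b l}" if "x \<in> ?gap k" "l < r" for x l
    proof
      assume x: "x \<in> {a l..b l}"
      have "k \<le> l"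
        using ordered_intervals_index_mono[OF I2 kr(2) that(2), of "b k" x] le kr x that(1) by auto
      moreover have "l \<le> Suc k" "l \<noteq> k"
        using ordered_intervals_index_mono[OF I2 that(2) kr(1), of x "a (Suc k)"] le kr x that(1) by auto
      ultimately have "l = Suc k"
        by simp
      then show False
        using x that(1) by simp
    qed
    ultimately have "?gap k \<subseteq> \<Union>?I1 - \<Union>?I2"
      by blast
    then show "?gap k \<in> components (\<Union>?I1 - \<Union>?I2)"
      using open_interval_in_components[OF less] ends by blast
  qed
  show ?thesis
  proof (intro equalityI subsetI)
    fix C assume "C \<in> ?gap ` ?G"
    then obtain k where k: "k \<in> ?G" "C = ?gap k"
      by blast
    have "closure (?gap k) - ?gap k \<subseteq> {b k, a (Suc k)}"
      using less[OF k(1)] by auto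
    then have "frontier (?gap k) \<subseteq> {b k, a (Suc k)}"
      by (simp add: frontier_def)
    then show "C \<in> gaps ?I1 ?I2"
      using comp[OF k(1)] ends[OF k(1)] k(2) unfolding gaps_def by blast
  next
    fix C assume "C \<in> gaps ?I1 ?I2"
    then have C: "C \<in> components (\<Union>?I1 - \<Union>?I2)" and fr: "frontier C \<subseteq> \<Union>?I2"
      by (auto simp: gaps_def)
    have con: "connected C" and sub: "C \<subseteq> \<Union>?I1 - \<Union>?I2"
      using in_components_connected[OF C] in_components_subset[OF C] by blast+
    obtain x where x: "x \<in> C"
      using in_components_nonempty[OF C] by blast
    obtain i where i: "i < q" "x \<in> {c i..d i}"
      using x sub by blast
    have Ci: "C \<subseteq> {c i..d i}"
      by (rule connected_in_disjoint_closed[OF con _ i(1) _ _ ordered_intervals_disjoint[OF I1]])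
        (use sub x i in auto)
    have "bounded C"
      using Ci bounded_closed_interval bounded_subset by blast
    then have IS: "Inf C \<in> frontier C" "Sup C \<in> frontier C"
      using Inf_Sup_in_frontier x by blast+
    obtain k where k: "k < r" "Inf C \<in> {a k..b k}"
      using IS fr by blast
    obtain m where m: "m < r" "Sup C \<in> {a m..b m}"
      using IS fr by blast
    have "closure C \<subseteq> {c i..d i}"
      by (rule closure_minimal[OF Ci]) simp
    then have ISi: "Inf C \<in> {c i..d i}" "Sup C \<in> {c i..d i}"
      using IS by (auto simp: frontier_def)
    have "\<beta> k = i"
      using ordered_intervals_index_unique[OF I1 _ i(1) _ ISi(1)] \<beta>[OF k(1)] k(2) by blast
    have "\<beta> m = i"
      using ordered_intervals_index_unique[OF I1 _ i(1) _ ISi(2)] \<beta>[OF m(1)] m(2) by blast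
    have "Inf C \<le> x" "x \<le> Sup C"
      using x \<open>bounded C\<close> by (auto intro: cInf_lower cSup_upper
        simp: bounded_imp_bdd_below bounded_imp_bdd_above)
    moreover have "x \<notin> {a l..b l}" if "l < r" for l
      using x sub that by blast
    ultimately have xkm: "b k < x" "x < a m"
      using k m by force+
    define l where "l = Max {l. l < r \<and> b l < x}"
    have fin: "finite {l. l < r \<and> b l < x}"
      by simp
    have l: "l < r" "b l < x" and kl: "k \<le> l"
      using Max_in[OF fin] Max_ge[OF fin, of k] k(1) xkm(1) unfolding l_def by blast+
    have "l < m"
      using xkm(2) l(2) le[OF l(1)] le[OF m(1)] lt[of m l] l(1) by (cases l m rule: linorder_cases) auto
    then have "Suc l < r"
      using m(1) by simp
    have "\<not> b (Suc l) < x"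
      using Max_ge[OF fin, of "Suc l"] \<open>Suc l < r\<close> unfolding l_def by fastforce
    then have "x < a (Suc l)"
      using \<open>\<And>l. l < r \<Longrightarrow> x \<notin> {a l..b l}\<close>[OF \<open>Suc l < r\<close>] by auto
    have "\<beta> l = i" "\<beta> (Suc l) = i"
      using containing_index_convex[OF I1 I2 \<beta>, of k _ m] kl \<open>l < m\<close> m(1) \<open>\<beta> k = i\<close> \<open>\<beta> m = i\<close>
      by auto
    then have lG: "l \<in> ?G"
      using \<open>Suc l < r\<close> by (simp add: gap_indices_def)
    have "C = ?gap l"
      using components_eq[OF C comp[OF lG]] x l(2) \<open>x < a (Suc l)\<close> by auto
    then show "C \<in> ?gap ` ?G"
      using lG by blast
  qed
qed

section \<open>Existence of splittings\<close>

theorem theoremA: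
  fixes f :: "real \<Rightarrow> real" and \<I>1 \<I>2 :: "real set set"
  assumes "continuous_on {0..1} f"
    and "f ` {0..1} \<subseteq> {0..1}"
    and "interval_cycle f \<I>1"
    and "interval_cycle f \<I>2"
    and "cycle_refines \<I>2 \<I>1"
  shows "\<exists>P. splitting f \<I>1 \<I>2 P"
proof -
  obtain q c d \<rho> where \<I>1: "\<I>1 = (\<lambda>i. {c i..d i}) ` {..<q}"
    and I1: "ordered_intervals q c d"
    and \<rho>: "bij_betw \<rho> {..<q} {..<q}"
    and \<rho>f: "\<And>i. i < q \<Longrightarrow> f ` {c i..d i} \<subseteq> {c (\<rho> i)..d (\<rho> i)}"
    by (rule interval_cycle_ordered[OF assms(3)]) (rule that; assumption)
  obtain r a b \<pi> where \<I>2: "\<I>2 = (\<lambda>k. {a k..b k}) ` {..<r}"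
    and I2: "ordered_intervals r a b"
    and unit: "\<And>k. k < r \<Longrightarrow> {a k..b k} \<subseteq> {0..1}"
    and \<pi>: "bij_betw \<pi> {..<r} {..<r}"
    and \<pi>f: "\<And>k. k < r \<Longrightarrow> f ` {a k..b k} \<subseteq> {a (\<pi> k)..b (\<pi> k)}"
    and period: "\<And>k n. k < r \<Longrightarrow> (\<pi> ^^ n) k = k \<Longrightarrow> n \<ge> 1 \<Longrightarrow> r \<le> n"
    by (rule interval_cycle_ordered[OF assms(4)]) (rule that; assumption)
  have le: "a k \<le> b k" if "k < r" for k
    using I2 that by (simp add: ordered_intervals_def)
  have lt: "b k < a l" if "k < l" "l < r" for k l
    using I2 that by (simp add: ordered_intervals_def)
  have \<pi>f': "f x \<in> {a (\<pi> k)..b (\<pi> k)}" if "k < r" "x \<in> {a k..b k}" for k x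
    using \<pi>f[OF that(1)] that(2) by blast
  have \<pi>r: "\<pi> k < r" if "k < r" for k
    using bij_betwE[OF \<pi>] that by auto
  have "\<exists>i<q. {a k..b k} \<subseteq> {c i..d i}" if "k < r" for k
  proof -
    have sub: "{a k..b k} \<subseteq> (\<Union>i<q. {c i..d i})"
      using assms(5) that unfolding cycle_refines_def \<I>1 \<I>2 by blast
    have "a k \<in> {a k..b k}"
      using le[OF that] by simp
    then obtain i where i: "i < q" "a k \<in> {c i..d i}"
      using sub by blast
    have "{a k..b k} \<subseteq> {c i..d i}"
      by (rule connected_in_disjoint_closed[OF _ sub i(1) _ _ ordered_intervals_disjoint[OF I1]])
        (use le[OF that] i in auto)
    then show ?thesis
      using i by blast
  qed
  then obtain \<beta> where \<beta>: "\<And>k. k < r \<Longrightarrow> \<beta> k < q \<and> {a k..b k} \<subseteq> {c (\<beta> k)..d (\<beta> k)}"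
    by metis
  let ?G = "gap_indices r \<beta>"
  have gaps: "gaps \<I>1 \<I>2 = (\<lambda>k. {b k<..<a (Suc k)}) ` ?G"
    unfolding \<I>1 \<I>2 by (rule gaps_ordered_intervals[OF I1 I2 \<beta>])
  have \<beta>\<pi>: "\<beta> (\<pi> k) = \<rho> (\<beta> k)" if "k < r" for k
  proof (rule ordered_intervals_index_unique[OF I1])
    have "f (a k) \<in> {a (\<pi> k)..b (\<pi> k)}"
      using le[OF that] by (intro \<pi>f'[OF that]) simp
    then show "f (a k) \<in> {c (\<beta> (\<pi> k))..d (\<beta> (\<pi> k))}"
      using \<beta>[OF \<pi>r[OF that]] by blast
    have "a k \<in> {c (\<beta> k)..d (\<beta> k)}"
      using \<beta>[OF that] le[OF that] by auto
    then show "f (a k) \<in> {c (\<rho> (\<beta> k))..d (\<rho> (\<beta> k))}"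
      using \<rho>f \<beta>[OF that] by blast
    show "\<beta> (\<pi> k) < q" "\<rho> (\<beta> k) < q"
      using \<beta> \<pi>r that bij_betwE[OF \<rho>] by auto
  qed
  have block: "\<beta> (\<pi> k) = \<beta> (\<pi> l) \<longleftrightarrow> \<beta> k = \<beta> l" if "k < r" "l < r" for k l
  proof -
    have "inj_on \<rho> {..<q}"
      using \<rho> by (simp add: bij_betw_def)
    then show ?thesis
      using \<beta> that by (simp add: \<beta>\<pi> inj_on_eq_iff)
  qed
  have "\<exists>\<sigma>. \<sigma> permutes ?G \<and> (\<forall>k\<in>?G.
      \<pi> k \<le> \<sigma> k \<and> \<sigma> k < \<pi> (Suc k) \<or> \<pi> (Suc k) \<le> \<sigma> k \<and> \<sigma> k < \<pi> k)"
  proof (rule gap_transversal[OF \<pi>])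
    show "\<beta> l = \<beta> m" if "k \<le> l" "l \<le> m" "m < r" "\<beta> k = \<beta> m" for k l m
      by (rule containing_index_convex[OF I1 I2 \<beta> that])
  qed (rule block)
  then obtain \<sigma> where \<sigma>: "\<sigma> permutes ?G"
    and between: "\<And>k. k \<in> ?G \<Longrightarrow>
      \<pi> k \<le> \<sigma> k \<and> \<sigma> k < \<pi> (Suc k) \<or> \<pi> (Suc k) \<le> \<sigma> k \<and> \<sigma> k < \<pi> k"
    by blast
  have G: "k < r" "Suc k < r" if "k \<in> ?G" for k
    using that by (auto simp: gap_indices_def)
  have "finite ?G"
    by (rule finite_subset[of _ "{..<r}"]) (use G in auto)
  have perm: "permutation \<sigma>"
    using \<sigma> \<open>finite ?G\<close> by (auto simp: permutation_permutes)
  have \<sigma>G: "\<sigma> k \<in> ?G" if "k \<in> ?G" for k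
    using permutes_in_image[OF \<sigma>] that by simp
  have \<sigma>powG: "(\<sigma> ^^ j) k \<in> ?G" if "k \<in> ?G" for j k
    by (induction j) (use that \<sigma>G in auto)
  have cover: "f (b k) \<le> b (\<sigma> k) \<and> a (Suc (\<sigma> k)) \<le> f (a (Suc k)) \<or>
      f (a (Suc k)) \<le> b (\<sigma> k) \<and> a (Suc (\<sigma> k)) \<le> f (b k)" if k: "k \<in> ?G" for k
  proof -
    have mono: "b m \<le> b n" "a m \<le> a n" if "m \<le> n" "n < r" for m n
      using that le[of m] le[of n] lt[of m n] by (cases "m = n"; force)+
    have s: "\<sigma> k < r" "Suc (\<sigma> k) < r"
      using G[OF \<sigma>G[OF k]] by auto
    have "f (b k) \<in> {a (\<pi> k)..b (\<pi> k)}"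
      using le[of k] G[OF k] by (intro \<pi>f') simp_all
    moreover have "f (a (Suc k)) \<in> {a (\<pi> (Suc k))..b (\<pi> (Suc k))}"
      using le[of "Suc k"] G[OF k] by (intro \<pi>f') simp_all
    ultimately show ?thesis
      using between[OF k] mono[of "\<pi> k" "\<sigma> k"] mono[of "Suc (\<sigma> k)" "\<pi> (Suc k)"]
        mono[of "\<pi> (Suc k)" "\<sigma> k"] mono[of "Suc (\<sigma> k)" "\<pi> k"] s \<pi>r[of k] \<pi>r[of "Suc k"] G[OF k]
      by auto
  qed
  \<comment> \<open>The last interval has no gap on its right, so there are at most \<open>r - 1\<close> gaps.\<close>
  have short: "least_power \<sigma> k < r" if k: "k \<in> ?G" for k
  proof -
    have "least_power \<sigma> k = card (set (support \<sigma> k))"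
      using distinct_card[OF cycle_of_permutation[OF perm, of k]] by simp
    also have "\<dots> \<le> card ?G"
      by (rule card_mono[OF \<open>finite ?G\<close>]) (use \<sigma>powG[OF k] in auto)
    also have "\<dots> \<le> card {..<r - 1}"
      by (rule card_mono) (auto simp: gap_indices_def)
    finally show ?thesis
      using G[OF k] by simp
  qed
  have loop: "\<exists>x. (f ^^ least_power \<sigma> k) x = x \<and>
      (\<forall>j. (f ^^ j) x \<in> {b ((\<sigma> ^^ j) k)<..<a (Suc ((\<sigma> ^^ j) k))})" if k: "k \<in> ?G" for k
  proof -
    let ?n = "least_power \<sigma> k"
    have n: "?n \<ge> 1" "(\<sigma> ^^ ?n) k = k"
      using least_power_of_permutation[OF perm, of k] by auto
    define u v where "u j = b ((\<sigma> ^^ j) k)" and "v j = a (Suc ((\<sigma> ^^ j) k))" for j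
    have uv_r: "(\<sigma> ^^ j) k < r" "Suc ((\<sigma> ^^ j) k) < r" for j
      using G[OF \<sigma>powG[OF k]] by auto
    have "{u j..v j} \<subseteq> {0..1}" for j
      using unit[OF uv_r(1)[of j]] unit[OF uv_r(2)[of j]] le[OF uv_r(1)[of j]] le[OF uv_r(2)[of j]]
      by (simp add: u_def v_def)
    then have cont: "continuous_on {u j..v j} f" for j
      using continuous_on_subset[OF assms(1)] by blast
    have u_le_v: "u j \<le> v j" for j
      using lt[OF lessI uv_r(2)] by (simp add: u_def v_def less_imp_le)
    have covers: "f (u j) \<le> u (Suc j) \<and> v (Suc j) \<le> f (v j) \<or>
        f (v j) \<le> u (Suc j) \<and> v (Suc j) \<le> f (u j)" for j
      using cover[OF \<sigma>powG[OF k, of j]] by (simp add: u_def v_def)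
    have "u ?n = u 0" "v ?n = v 0"
      using n(2) by (simp_all add: u_def v_def)
    then have "\<exists>x. (f ^^ ?n) x = x \<and> (\<forall>j\<le>?n. (f ^^ j) x \<in> {u j..v j})"
      by (rule covering_loop_periodic_point[of u v f, OF u_le_v cont covers])
    then obtain x where x: "(f ^^ ?n) x = x" "\<And>j. j \<le> ?n \<Longrightarrow> (f ^^ j) x \<in> {u j..v j}"
      by blast
    have itin: "(f ^^ j) x \<in> {u j..v j}" for j
    proof -
      have "(f ^^ (j mod ?n)) x \<in> {u (j mod ?n)..v (j mod ?n)}"
        using n(1) by (intro x(2) less_imp_le mod_less_divisor) simp
      then show ?thesis
        by (simp add: u_def v_def funpow_mod_eq[OF x(1)] funpow_mod_eq[OF n(2)])
    qed
    \<comment> \<open>An orbit of period \<open>n < r\<close> cannot meet \<open>\<Union>\<I>2\<close>, whose intervals return only at time \<open>r\<close>. This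
        also covers intervals that are single points, where an endpoint of a gap can be periodic.\<close>
    have avoid: "(f ^^ j) x \<notin> {a m..b m}" if "m < r" for j m
    proof
      assume y: "(f ^^ j) x \<in> {a m..b m}"
      have orbit: "(\<pi> ^^ i) m < r \<and> (f ^^ i) ((f ^^ j) x) \<in> {a ((\<pi> ^^ i) m)..b ((\<pi> ^^ i) m)}" for i
      proof (induction i)
        case 0
        then show ?case
          using y \<open>m < r\<close> by simp
      next
        case (Suc i)
        then show ?case
          using \<pi>r[of "(\<pi> ^^ i) m"] \<pi>f'[of "(\<pi> ^^ i) m"] by simp
      qed
      have "(f ^^ ?n) ((f ^^ j) x) = (f ^^ j) ((f ^^ ?n) x)"
        by (metis add.commute comp_apply funpow_add)
      then have "(f ^^ j) x \<in> {a ((\<pi> ^^ ?n) m)..b ((\<pi> ^^ ?n) m)}"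
        using orbit[of ?n] x(1) by simp
      then have "(\<pi> ^^ ?n) m = m"
        using ordered_intervals_index_unique[OF I2 _ that _ y] orbit[of ?n] by blast
      then have "r \<le> ?n"
        using period[OF that] n(1) by blast
      then show False
        using short[OF k] by simp
    qed
    have "(f ^^ j) x \<in> {u j<..<v j}" for j
      using itin[of j] avoid[OF uv_r(1)[of j], of j] avoid[OF uv_r(2)[of j], of j]
        le[OF uv_r(1)[of j]] le[OF uv_r(2)[of j]] by (auto simp: u_def v_def less_le)
    then show ?thesis
      using x(1) unfolding u_def v_def by blast
  qed
  have "\<exists>p. \<forall>k\<in>?G. p k \<in> {b k<..<a (Suc k)} \<and> p (\<sigma> k) = f (p k) \<and> periodic_point f (p k)"
    by (rule equivariant_choice[of \<sigma> ?G f "\<lambda>k x. x \<in> {b k<..<a (Suc k)}", OF perm \<sigma>G loop])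
  then obtain p where p: "\<And>k. k \<in> ?G \<Longrightarrow> p k \<in> {b k<..<a (Suc k)}"
    "\<And>k. k \<in> ?G \<Longrightarrow> p (\<sigma> k) = f (p k)" "\<And>k. k \<in> ?G \<Longrightarrow> periodic_point f (p k)"
    by blast
  have same_gap: "k = l" if "k \<in> ?G" "l \<in> ?G" "p k \<in> {b l<..<a (Suc l)}" for k l
  proof (rule ccontr)
    assume "k \<noteq> l"
    then have "a (Suc k) \<le> b l \<or> a (Suc l) \<le> b k"
    proof (cases k l rule: linorder_cases)
      case less
      then show ?thesis
        using le[of "Suc k"] le[of l] lt[of "Suc k" l] G[OF that(1)] G[OF that(2)]
        by (cases "Suc k = l") auto
    next
      case greater
      then show ?thesis
        using le[of "Suc l"] le[of k] lt[of "Suc l" k] G[OF that(1)] G[OF that(2)]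
        by (cases "Suc l = k") auto
    qed simp
    then show False
      using p(1)[OF that(1)] that(3) by auto
  qed
  have "splitting f \<I>1 \<I>2 (p ` ?G)"
    unfolding splitting_def gaps
  proof (intro conjI ballI)
    show "p ` ?G \<subseteq> {0..1}"
    proof
      fix x assume "x \<in> p ` ?G"
      then obtain k where k: "k \<in> ?G" "x = p k"
        by blast
      have "b k \<in> {0..1}" "a (Suc k) \<in> {0..1}"
        using unit[of k] unit[of "Suc k"] le[of k] le[of "Suc k"] G[OF k(1)] by auto
      then show "x \<in> {0..1}"
        using p(1)[OF k(1)] k(2) by auto
    qed
    show "f ` p ` ?G \<subseteq> p ` ?G"
    proof
      fix y assume "y \<in> f ` p ` ?G"
      then obtain k where k: "k \<in> ?G" "y = f (p k)"
        by blast
      then have "y = p (\<sigma> k)"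
        using p(2) by simp
      then show "y \<in> p ` ?G"
        using \<sigma>G k(1) by blast
    qed
    show "p ` ?G \<subseteq> \<Union> ((\<lambda>k. {b k<..<a (Suc k)}) ` ?G)"
      using p(1) by blast
  next
    fix x assume "x \<in> p ` ?G"
    then show "periodic_point f x"
      using p(3) by blast
  next
    fix C assume "C \<in> (\<lambda>k. {b k<..<a (Suc k)}) ` ?G"
    then obtain l where l: "l \<in> ?G" "C = {b l<..<a (Suc l)}"
      by blast
    show "\<exists>!x. x \<in> p ` ?G \<and> x \<in> C"
    proof (rule ex1I[of _ "p l"])
      show "p l \<in> p ` ?G \<and> p l \<in> C"
        using l p(1) by blast
      fix x assume "x \<in> p ` ?G \<and> x \<in> C"
      then show "x = p l"
        using same_gap l by blast
    qed
  qed
  then show ?thesis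
    by blast
qed

end
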